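(* Let $N = Z\cup H$ with $Z$ a finite set of providers and $H$ a finite set of $\eta=|H|$ peers, and let the worth $\hat v$ of coalitions with at most one provider be given as in the context, with non-negative cost functions $\Omega_p^\eta$ that are non-increasing for every $p\in Z$. Then there exists a unique worth function $v':2^N\to\mathbb{R}$ which agrees with $\hat v$ on all coalitions containing at most one provider and which is both superadditive and feasible. It is $v'=v$, where $v(S)=\hat v(S)$ if $|Z\cap S|\le 1$ and, if $|Z\cap S|\ge 2$, $$v(S)=\max\Big\{\sum_{C\in\mathcal P}\hat v(C)\ \Big|\ \mathcal P \text{ a partition of } S \text{ with } |Z\cap C|=1 \text{ for all } C\in\mathcal P\Big\}.$$
   Context: The player set is $N=Z\cup H$, a disjoint union of a finite set $Z$ of providers and a finite set $H$ of $\eta$ homogeneous peers. For $p\in Z$, $\Omega_p^\eta(x)\ge 0$ is the operational cost of provider $p$ when a fraction $x\in\{0,1/\eta,\dots,1\}$ of the peers assists it; $\Omega_p^\eta$ is non-increasing in $x$. A worth function is a map $2^N\to\mathbb{R}$ with value $0$ at $\emptyset$. For a coalition $S\subseteq N$ with exactly one provider $p$, $\hat v(S):=\Omega_p^\eta(0)-\Omega_p^\eta(x(S))$ with $x(S)=|S\cap H|/\eta$; for a coalition $S$ with no provider, $\hat v(S):=0$. A worth function $v'$ is superadditive if $v'(S\cup T)\ge v'(S)+v'(T)$ for all disjoint $S,T\subseteq N$. A worth function $v'$ is feasible if, for every $S\subseteq N$, $v'(S)$ does not exceed the maximal total cost reduction attainable by distributing the peers of $S$ among the providers of $S$, i.e.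 $v'(S)\le \max\{\sum_{C\in\mathcal P}\hat v(C)\mid \mathcal P$ a partition of $S$ with $|Z\cap C|=1$ for all $C\in\mathcal P\}$ when $Z\cap S\neq\emptyset$, and $v'(S)\le 0$ when $Z\cap S=\emptyset$. *)

theory Defs
  imports Complex_Main "HOL-Library.FuncSet" "HOL-Library.Disjoint_Sets"
begin

text \<open>
  Throughout, \<open>Z\<close> is the set of providers and \<open>H\<close> the set of peers. The number of peers
  \<open>\<eta> = card H\<close> is fixed, so the cost function of provider \<open>p\<close> is written \<open>\<Omega> p\<close> without the
  superscript \<open>\<eta>\<close>. It is a function on the reals of which only the values on
  \<open>fractions H\<close> matter.
\<close>

definition fractions :: "'a set \<Rightarrow> real set" where
  "fractions H = {real k / real (card H) | k. k \<le> card H}"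

definition peer_fraction :: "'a set \<Rightarrow> 'a set \<Rightarrow> real" where
  "peer_fraction H S = real (card (S \<inter> H)) / real (card H)"

text \<open>The worth is unspecified for coalitions with two or more providers.\<close>

definition v_hat :: "'a set \<Rightarrow> 'a set \<Rightarrow> ('a \<Rightarrow> real \<Rightarrow> real) \<Rightarrow> 'a set \<Rightarrow> real" where
  "v_hat Z H \<Omega> S =
    (if Z \<inter> S = {} then 0
     else if card (Z \<inter> S) = 1 then
       (let p = the_elem (Z \<inter> S) in \<Omega> p 0 - \<Omega> p (peer_fraction H S))
     else undefined)"

definition one_provider_partitions :: "'a set \<Rightarrow> 'a set \<Rightarrow> 'a set set set" where
  "one_provider_partitions Z S = {P. partition_on S P \<and> (\<forall>C\<in>P. card (Z \<inter> C) = 1)}"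

definition max_reduction :: "'a set \<Rightarrow> 'a set \<Rightarrow> ('a \<Rightarrow> real \<Rightarrow> real) \<Rightarrow> 'a set \<Rightarrow> real" where
  "max_reduction Z H \<Omega> S =
    Max {\<Sum>C\<in>P. v_hat Z H \<Omega> C | P. P \<in> one_provider_partitions Z S}"

text \<open>
  The maximum is only used when \<open>S\<close> is finite and contains a provider; it then ranges
  over a finite nonempty set.
\<close>

lemma finite_one_provider_partitions:
  assumes "finite S"
  shows "finite (one_provider_partitions Z S)"
  using finitely_many_partition_on[OF assms]
  by (rule finite_subset[rotated]) (auto simp: one_provider_partitions_def)

lemma one_provider_partitions_nonempty:
  assumes "Z \<inter> S \<noteq> {}"
  shows "one_provider_partitions Z S \<noteq> {}"
proof -
  from assms obtain p where p: "p \<in> Z" "p \<in> S" by blast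
  let ?B = "insert p (S - Z)"
  let ?P = "insert ?B ((\<lambda>q. {q}) ` (Z \<inter> S - {p}))"
  have "partition_on S ?P"
    using p by (auto simp: partition_on_def disjoint_def)
  moreover have "Z \<inter> ?B = {p}" using p by auto
  then have "\<forall>C\<in>?P. card (Z \<inter> C) = 1" by auto
  ultimately show ?thesis by (auto simp: one_provider_partitions_def)
qed

text \<open>
  Worth functions are extensional on \<open>Pow N\<close>, so that equality of HOL functions is
  equality of functions with domain \<open>Pow N\<close>.
\<close>

definition worth_functions :: "'a set \<Rightarrow> ('a set \<Rightarrow> real) set" where
  "worth_functions N = {v \<in> Pow N \<rightarrow>\<^sub>E UNIV. v {} = 0}"

definition superadditive :: "'a set \<Rightarrow> ('a set \<Rightarrow> real) \<Rightarrow> bool" where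
  "superadditive N v \<longleftrightarrow>
    (\<forall>S T. S \<subseteq> N \<longrightarrow> T \<subseteq> N \<longrightarrow> S \<inter> T = {} \<longrightarrow> v (S \<union> T) \<ge> v S + v T)"

definition feasible ::
    "'a set \<Rightarrow> 'a set \<Rightarrow> ('a \<Rightarrow> real \<Rightarrow> real) \<Rightarrow> ('a set \<Rightarrow> real) \<Rightarrow> bool" where
  "feasible Z H \<Omega> v \<longleftrightarrow>
    (\<forall>S. S \<subseteq> Z \<union> H \<longrightarrow> v S \<le> (if Z \<inter> S = {} then 0 else max_reduction Z H \<Omega> S))"

definition agrees_with_v_hat ::
    "'a set \<Rightarrow> 'a set \<Rightarrow> ('a \<Rightarrow> real \<Rightarrow> real) \<Rightarrow> ('a set \<Rightarrow> real) \<Rightarrow> bool" where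
  "agrees_with_v_hat Z H \<Omega> v \<longleftrightarrow>
    (\<forall>S. S \<subseteq> Z \<union> H \<longrightarrow> card (Z \<inter> S) \<le> 1 \<longrightarrow> v S = v_hat Z H \<Omega> S)"

definition coalition_worth :: "'a set \<Rightarrow> 'a set \<Rightarrow> ('a \<Rightarrow> real \<Rightarrow> real) \<Rightarrow> 'a set \<Rightarrow> real" where
  "coalition_worth Z H \<Omega> =
    restrict (\<lambda>S. if card (Z \<inter> S) \<le> 1 then v_hat Z H \<Omega> S else max_reduction Z H \<Omega> S)
      (Pow (Z \<union> H))"

end

theory Submission imports Defs begin

text \<open>
  On coalitions with at least one provider \<open>v\<close> is the maximal reduction throughout, because a
  coalition with exactly one provider has only the trivial one-provider partition. Optimal
  partitions of disjoint coalitions combine to a partition of the union, and peers that join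
  without a provider can be added to any block at no loss, since costs are non-increasing;
  so \<open>v\<close> is superadditive. Conversely, superadditivity along the blocks of a partition forces
  any admissible worth to be at least the maximal reduction, which feasibility makes an equality.
\<close>

lemma max_reduction_ge:
  assumes "finite S" and "P \<in> one_provider_partitions Z S"
  shows "(\<Sum>C\<in>P. v_hat Z H \<Omega> C) \<le> max_reduction Z H \<Omega> S"
  unfolding max_reduction_def
  using assms finite_one_provider_partitions[OF assms(1), of Z]
  by (intro Max_ge) (auto simp: Setcompr_eq_image)

lemma max_reduction_attained:
  assumes "finite S" and "Z \<inter> S \<noteq> {}"
  obtains P where "P \<in> one_provider_partitions Z S"
    and "max_reduction Z H \<Omega> S = (\<Sum>C\<in>P. v_hat Z H \<Omega> C)"
proof -
  let ?A = "(\<lambda>P. \<Sum>C\<in>P. v_hat Z H \<Omega> C) ` one_provider_partitions Z S"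
  have "Max ?A \<in> ?A"
    using finite_one_provider_partitions[OF assms(1)] one_provider_partitions_nonempty[OF assms(2)]
    by (intro Max_in) auto
  then show thesis
    using that by (auto simp: max_reduction_def Setcompr_eq_image)
qed

text \<open>Each block needs a provider and only one is available, so all blocks share it; by
  disjointness there is a single block.\<close>

lemma one_provider_partitions_single:
  assumes "card (Z \<inter> S) = 1"
  shows "one_provider_partitions Z S = {{S}}"
proof -
  obtain p where p: "Z \<inter> S = {p}"
    using assms card_1_singletonE by blast
  have "P = {S}" if "P \<in> one_provider_partitions Z S" for P
  proof -
    have part: "partition_on S P" and one: "\<And>C. C \<in> P \<Longrightarrow> card (Z \<inter> C) = 1"
      using that by (auto simp: one_provider_partitions_def)
    have "p \<in> C" if "C \<in> P" for C
    proof -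
      have "Z \<inter> C \<subseteq> {p}" using p part that by (auto simp: partition_on_def)
      moreover have "Z \<inter> C \<noteq> {}" using one[OF that] by auto
      ultimately show ?thesis by blast
    qed
    then have eq: "C = D" if "C \<in> P" "D \<in> P" for C D
      using part that unfolding partition_on_def disjoint_def by blast
    obtain C where "C \<in> P" using part p by (auto simp: partition_on_def)
    with eq have "P = {C}" by blast
    then show ?thesis using part by (auto simp: partition_on_def)
  qed
  moreover have "{S} \<in> one_provider_partitions Z S"
    using assms p by (auto simp: one_provider_partitions_def partition_on_def)
  ultimately show ?thesis by blast
qed

lemma max_reduction_single:
  assumes "card (Z \<inter> S) = 1"
  shows "max_reduction Z H \<Omega> S = v_hat Z H \<Omega> S"
  by (simp add: max_reduction_def one_provider_partitions_single[OF assms])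

text \<open>Antimonotonicity of the costs is given only on \<open>fractions H\<close>, so the
  arguments at which costs are compared have to lie there.\<close>

lemma peer_fraction_in_fractions:
  assumes "finite H"
  shows "peer_fraction H S \<in> fractions H"
  using card_mono[OF assms, of "S \<inter> H"] by (auto simp: peer_fraction_def fractions_def)

text \<open>Joining \<open>T\<close> keeps the provider and can only raise the peer fraction, so its
  cost does not increase.\<close>

lemma v_hat_mono_peers:
  assumes "finite H" and "\<And>p. p \<in> Z \<Longrightarrow> antimono_on (fractions H) (\<Omega> p)"
    and "card (Z \<inter> C) = 1" and "Z \<inter> T = {}"
  shows "v_hat Z H \<Omega> C \<le> v_hat Z H \<Omega> (C \<union> T)"
proof -
  obtain p where p: "Z \<inter> C = {p}"
    using assms(3) card_1_singletonE by blast
  then have pT: "Z \<inter> (C \<union> T) = {p}" using assms(4) by blast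
  have "card (C \<inter> H) \<le> card ((C \<union> T) \<inter> H)"
    using assms(1) by (intro card_mono) auto
  then have "peer_fraction H C \<le> peer_fraction H (C \<union> T)"
    by (auto simp: peer_fraction_def intro!: divide_right_mono)
  moreover have "antimono_on (fractions H) (\<Omega> p)" using p assms(2) by blast
  ultimately have "\<Omega> p (peer_fraction H (C \<union> T)) \<le> \<Omega> p (peer_fraction H C)"
    using peer_fraction_in_fractions[OF assms(1)] by (auto simp: monotone_on_def)
  then show ?thesis by (simp add: v_hat_def p pT)
qed

text \<open>This single formula, which is also the bound in \<open>feasible\<close>, replaces the
  case split at one provider by a split at none. Finiteness of \<open>Z\<close> ensures that
  \<open>card (Z \<inter> S) = 0\<close> really means no provider.\<close>

lemma coalition_worth_eq:
  assumes "finite Z" and "S \<subseteq> Z \<union> H"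
  shows "coalition_worth Z H \<Omega> S = (if Z \<inter> S = {} then 0 else max_reduction Z H \<Omega> S)"
proof (cases "card (Z \<inter> S) \<le> 1")
  case True
  then show ?thesis
    using assms max_reduction_single[of Z S H \<Omega>]
    by (cases "Z \<inter> S = {}")
       (auto simp: coalition_worth_def v_hat_def le_Suc_eq)
next
  case False
  then show ?thesis using assms by (auto simp: coalition_worth_def)
qed

lemma max_reduction_superadditive:
  assumes "finite S" and "finite T" and "S \<inter> T = {}" and "Z \<inter> S \<noteq> {}" and "Z \<inter> T \<noteq> {}"
  shows "max_reduction Z H \<Omega> S + max_reduction Z H \<Omega> T \<le> max_reduction Z H \<Omega> (S \<union> T)"
proof -
  obtain P where P: "P \<in> one_provider_partitions Z S"
      "max_reduction Z H \<Omega> S = (\<Sum>C\<in>P. v_hat Z H \<Omega> C)"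
    using max_reduction_attained[OF assms(1,4)] .
  obtain Q where Q: "Q \<in> one_provider_partitions Z T"
      "max_reduction Z H \<Omega> T = (\<Sum>C\<in>Q. v_hat Z H \<Omega> C)"
    using max_reduction_attained[OF assms(2,5)] .
  have part: "partition_on S P" "partition_on T Q"
    using P Q by (auto simp: one_provider_partitions_def)
  then have fin: "finite P" "finite Q"
    using assms finite_elements by blast+
  \<comment> \<open>A common block would be a nonempty subset of \<open>S \<inter> T\<close>. Hence
    \<open>P\<close> and \<open>Q\<close> share no block and the sum over their union
    splits.\<close>
  have "C \<subseteq> S \<inter> T \<and> C \<noteq> {}" if "C \<in> P" "C \<in> Q" for C
    using that part by (auto simp: partition_on_def)
  with assms(3) have "P \<inter> Q = {}" by blast
  then have "max_reduction Z H \<Omega> S + max_reduction Z H \<Omega> T = (\<Sum>C\<in>P \<union> Q. v_hat Z H \<Omega> C)"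
    using P Q fin by (simp add: sum.union_disjoint)
  moreover have "partition_on (S \<union> T) (P \<union> Q)"
    using part assms(3) by (fastforce simp: partition_on_def intro!: disjoint_union)
  then have "P \<union> Q \<in> one_provider_partitions Z (S \<union> T)"
    using P Q by (auto simp: one_provider_partitions_def)
  ultimately show ?thesis
    using max_reduction_ge[of "S \<union> T" "P \<union> Q" Z H \<Omega>] assms(1,2) by simp
qed

text \<open>A nonempty \<open>T\<close> without providers has no one-provider partition of its own,
  so this case of superadditivity needs a separate argument.\<close>

lemma max_reduction_mono_peers:
  assumes "finite H" and "\<And>p. p \<in> Z \<Longrightarrow> antimono_on (fractions H) (\<Omega> p)"
    and "finite S" and "finite T" and "S \<inter> T = {}" and "Z \<inter> S \<noteq> {}" and "Z \<inter> T = {}"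
  shows "max_reduction Z H \<Omega> S \<le> max_reduction Z H \<Omega> (S \<union> T)"
proof -
  obtain P where P: "P \<in> one_provider_partitions Z S"
      "max_reduction Z H \<Omega> S = (\<Sum>C\<in>P. v_hat Z H \<Omega> C)"
    using max_reduction_attained[OF assms(3,6)] .
  have part: "partition_on S P" and one: "\<And>C. C \<in> P \<Longrightarrow> card (Z \<inter> C) = 1"
    using P by (auto simp: one_provider_partitions_def)
  have fin: "finite P" using part assms(3) finite_elements by blast
  obtain C where C: "C \<in> P" using part assms(6) by (auto simp: partition_on_def)
  \<comment> \<open>All of \<open>T\<close> joins one arbitrary block \<open>C\<close> of an optimal
    partition of \<open>S\<close>.\<close>
  let ?Q = "insert (C \<union> T) (P - {C})"
  have sub: "D \<subseteq> S" if "D \<in> P" for D using part that by (auto simp: partition_on_def)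
  have disj: "C \<inter> D = {}" if "D \<in> P - {C}" for D
    using part that C by (auto simp: partition_on_def disjoint_def)
  have ne: "D \<noteq> {}" if "D \<in> P" for D using part that by (auto simp: partition_on_def)
  \<comment> \<open>If the enlarged block were already among the others, the sum over the set
    \<open>?Q\<close> would lose a summand. It cannot be, since it contains the nonempty
    \<open>C\<close>, from which the other blocks are disjoint.\<close>
  have notin: "C \<union> T \<notin> P - {C}" using disj[of "C \<union> T"] ne[OF C] by auto
  have "disjnt (C \<union> T) (\<Union>(P - {C}))"
    using disj sub assms(5) by (fastforce simp: disjnt_def)
  moreover have "disjoint (P - {C})"
    using part by (auto simp: partition_on_def disjoint_def)
  ultimately have "disjoint ?Q"
    by (auto simp: disjoint_def disjnt_def)
  moreover have "\<Union>?Q = S \<union> T"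
    using part C by (auto simp: partition_on_def)
  moreover have "{} \<notin> ?Q" using ne C by auto
  ultimately have "partition_on (S \<union> T) ?Q"
    by (simp add: partition_on_def)
  moreover have "Z \<inter> (C \<union> T) = Z \<inter> C" using assms(7) by blast
  ultimately have "?Q \<in> one_provider_partitions Z (S \<union> T)"
    using one C by (auto simp: one_provider_partitions_def)
  then have "(\<Sum>D\<in>?Q. v_hat Z H \<Omega> D) \<le> max_reduction Z H \<Omega> (S \<union> T)"
    using assms by (intro max_reduction_ge) auto
  moreover have "v_hat Z H \<Omega> C \<le> v_hat Z H \<Omega> (C \<union> T)"
    using v_hat_mono_peers[OF assms(1,2) one[OF C] assms(7)] .
  ultimately show ?thesis
    using P(2) fin notin C by (simp add: sum.remove[of P C])
qed

text \<open>Induction on the family splits off one block at a time; \<open>v {} = 0\<close> covers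
  the empty family.\<close>

lemma superadditive_sum_le:
  assumes "superadditive N v" and "v {} = 0" and "finite P" and "disjoint P" and "\<Union>P \<subseteq> N"
  shows "(\<Sum>C\<in>P. v C) \<le> v (\<Union>P)"
  using assms(3-5)
proof (induction P rule: finite_induct)
  case empty
  then show ?case using assms(2) by simp
next
  case (insert C P)
  then have "C \<inter> \<Union>P = {}" by (auto simp: disjoint_def)
  then have "v C + v (\<Union>P) \<le> v (C \<union> \<Union>P)"
    using assms(1) insert.prems by (simp add: superadditive_def)
  moreover have "(\<Sum>D\<in>P. v D) \<le> v (\<Union>P)"
    using insert by (intro insert.IH) (auto simp: disjoint_def)
  ultimately show ?case using insert.hyps by simp
qed

lemma max_reduction_le_superadditive:
  assumes "superadditive (Z \<union> H) v" and "v {} = 0" and "agrees_with_v_hat Z H \<Omega> v"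
    and "finite S" and "S \<subseteq> Z \<union> H" and "Z \<inter> S \<noteq> {}"
  shows "max_reduction Z H \<Omega> S \<le> v S"
proof -
  obtain P where P: "P \<in> one_provider_partitions Z S"
      "max_reduction Z H \<Omega> S = (\<Sum>C\<in>P. v_hat Z H \<Omega> C)"
    using max_reduction_attained[OF assms(4,6)] .
  have part: "partition_on S P" and one: "\<And>C. C \<in> P \<Longrightarrow> card (Z \<inter> C) = 1"
    using P by (auto simp: one_provider_partitions_def)
  then have US: "\<Union>P = S" "disjoint P" by (auto simp: partition_on_def)
  \<comment> \<open>Blocks hold exactly one provider, so the prescribed values apply to each of them
    and superadditivity of \<open>v\<close> can take over.\<close>
  have "v_hat Z H \<Omega> C = v C" if "C \<in> P" for C
  proof -
    have "C \<subseteq> Z \<union> H" using that US assms(5) by blast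
    then show ?thesis
      using assms(3) one[OF that] by (simp add: agrees_with_v_hat_def)
  qed
  then have "max_reduction Z H \<Omega> S = (\<Sum>C\<in>P. v C)" using P(2) by simp
  also have "\<dots> \<le> v (\<Union>P)"
    using assms part US finite_elements by (intro superadditive_sum_le) auto
  finally show ?thesis using US by simp
qed

theorem lemma1:
  fixes Z H :: "'a set" and \<Omega> :: "'a \<Rightarrow> real \<Rightarrow> real"
  assumes "finite Z" and "finite H" and "Z \<inter> H = {}"
    and "\<And>p x. p \<in> Z \<Longrightarrow> x \<in> fractions H \<Longrightarrow> \<Omega> p x \<ge> 0"
    and "\<And>p. p \<in> Z \<Longrightarrow> antimono_on (fractions H) (\<Omega> p)"
  shows "(\<exists>!v'. v' \<in> worth_functions (Z \<union> H) \<and> agrees_with_v_hat Z H \<Omega> v' \<and>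
            superadditive (Z \<union> H) v' \<and> feasible Z H \<Omega> v') \<and>
         (let v = coalition_worth Z H \<Omega> in
            v \<in> worth_functions (Z \<union> H) \<and> agrees_with_v_hat Z H \<Omega> v \<and>
            superadditive (Z \<union> H) v \<and> feasible Z H \<Omega> v)"
proof -
  let ?v = "coalition_worth Z H \<Omega>"
  let ?admissible = "\<lambda>v. v \<in> worth_functions (Z \<union> H) \<and> agrees_with_v_hat Z H \<Omega> v \<and>
      superadditive (Z \<union> H) v \<and> feasible Z H \<Omega> v"
  note eq = coalition_worth_eq[OF assms(1)]
  have fin: "finite S" if "S \<subseteq> Z \<union> H" for S
    using that assms(1,2) finite_subset by blast
  have "?v \<in> worth_functions (Z \<union> H)"
    using eq[of "{}"] by (auto simp: worth_functions_def coalition_worth_def)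
  moreover have "agrees_with_v_hat Z H \<Omega> ?v"
    by (auto simp: agrees_with_v_hat_def coalition_worth_def)
  moreover have "feasible Z H \<Omega> ?v"
    by (simp add: feasible_def eq)
  moreover have "?v S + ?v T \<le> ?v (S \<union> T)"
    if ST: "S \<subseteq> Z \<union> H" "T \<subseteq> Z \<union> H" "S \<inter> T = {}" for S T
  proof -
    note fS = fin[OF ST(1)] and fT = fin[OF ST(2)]
    have U: "S \<union> T \<subseteq> Z \<union> H" using ST by blast
    \<comment> \<open>If both coalitions have providers, optimal partitions are combined; if exactly
      one has, the other only contributes peers, in either order of \<open>S\<close> and
      \<open>T\<close>; if none has, all worths are 0.\<close>
    have "T \<inter> S = {}" using ST(3) by blast
    then show ?thesis
      using eq[OF ST(1)] eq[OF ST(2)] eq[OF U] max_reduction_superadditive[OF fS fT ST(3)]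
        max_reduction_mono_peers[OF assms(2,5) fS fT ST(3)]
        max_reduction_mono_peers[OF assms(2,5) fT fS]
      by (cases "Z \<inter> S = {}"; cases "Z \<inter> T = {}") (auto simp: Int_Un_distrib Un_commute)
  qed
  then have "superadditive (Z \<union> H) ?v"
    by (simp add: superadditive_def)
  ultimately have ex: "?admissible ?v" by blast
  \<comment> \<open>Both functions are extensional, so it suffices to compare them on subsets of
    \<open>Z \<union> H\<close>.\<close>
  have "v' = ?v" if adm: "?admissible v'" for v'
  proof (rule extensionalityI[where A = "Pow (Z \<union> H)"])
    show "v' \<in> extensional (Pow (Z \<union> H))" "?v \<in> extensional (Pow (Z \<union> H))"
      using adm ex by (auto simp: worth_functions_def PiE_def)
    fix S assume "S \<in> Pow (Z \<union> H)"
    then have S: "S \<subseteq> Z \<union> H" by simp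
    show "v' S = ?v S"
    proof (cases "Z \<inter> S = {}")
      case True
      then show ?thesis
        using adm S eq[OF S] by (simp add: agrees_with_v_hat_def v_hat_def)
    next
      case False
      \<comment> \<open>Superadditivity gives the lower bound and feasibility the matching upper
        bound.\<close>
      then have "max_reduction Z H \<Omega> S \<le> v' S"
        using adm S fin by (intro max_reduction_le_superadditive) (auto simp: worth_functions_def)
      moreover have "v' S \<le> max_reduction Z H \<Omega> S"
        using adm S False unfolding feasible_def by presburger
      ultimately show ?thesis using eq[OF S] False by simp
    qed
  qed
  then have "\<exists>!v'. ?admissible v'"
    by (rule ex1I[where P = ?admissible, OF ex])
  with ex show ?thesis unfolding Let_def by (rule conjI[rotated])
qed

end
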